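(* Let $k\ge 2$ and $P=\{A^k+B^k\mid A,B\in M_2(\mathbb F_2)\}$. Then $P=M_2(\mathbb F_2)$ if $k\not\equiv 0 \pmod 6$, and $P=M_2(\mathbb F_2)\setminus\left\{\begin{pmatrix}1&1\\1&0\end{pmatrix},\begin{pmatrix}0&1\\1&1\end{pmatrix}\right\}$ (the two invertible matrices of order 3) if $k\equiv 0\pmod 6$. *)

theory Defs
  imports
    "Jordan_Normal_Form.Matrix"
    "HOL-Library.Z2"
    "HOL-Algebra.Multiplicative_Group"
    "HOL-Number_Theory.Cong"
begin

abbreviation GL2_F2 :: "bit mat monoid" where
  "GL2_F2 \<equiv> units_of (ring_mat TYPE(bit) 2 ())"

end

theory Submission
  imports Defs
begin

text \<open>
  Idempotents are \<open>k\<close>-th powers for every \<open>k > 0\<close>, and the sums of two idempotents are exactly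
  the matrices that do not have order 3. If \<open>6\<close> divides \<open>k\<close>, then every \<open>k\<close>-th power is
  idempotent, because \<open>A^8 = A^2\<close> holds for all \<open>A\<close>, so nothing else is reached. Otherwise let
  \<open>M\<close> have order 3. If \<open>3\<close> does not divide \<open>k\<close>, then \<open>M\<close> is itself a \<open>k\<close>-th power of
  \<open>M\<close> or of \<open>M^2\<close>; if \<open>k\<close> is odd, then \<open>M\<close> is the sum of a diagonal idempotent and the swap
  matrix, and both of these are their own \<open>k\<close>-th powers.
\<close>

section \<open>Computing with explicit 2 by 2 matrices\<close>

definition mat2 :: "'a \<Rightarrow> 'a \<Rightarrow> 'a \<Rightarrow> 'a \<Rightarrow> 'a mat" where
  "mat2 a b c d = mat_of_rows_list 2 [[a, b], [c, d]]"

lemma less_2_nat: "i < (2::nat) \<longleftrightarrow> i = 0 \<or> i = 1"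
  by auto

lemma mat2_dim [simp]: "dim_row (mat2 a b c d) = 2" "dim_col (mat2 a b c d) = 2"
  by (simp_all add: mat2_def mat_of_rows_list_def)

lemma mat2_carrier [simp]: "mat2 a b c d \<in> carrier_mat 2 2"
  by (rule carrier_matI) simp_all

lemma mat2_index [simp]:
  "mat2 a b c d $$ (0, 0) = a" "mat2 a b c d $$ (0, Suc 0) = b"
  "mat2 a b c d $$ (Suc 0, 0) = c" "mat2 a b c d $$ (Suc 0, Suc 0) = d"
  by (simp_all add: mat2_def mat_of_rows_list_def)

lemma mat2_eq_iff [simp]:
  "mat2 a b c d = mat2 a' b' c' d' \<longleftrightarrow> a = a' \<and> b = b' \<and> c = c' \<and> d = d'"
  by (metis mat2_index)

text \<open>Over \<open>bit\<close>, this turns a claim about all matrices into a finite case split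
  on the entries, which the simplifier evaluates.\<close>

lemma carrier_mat_2_cases:
  assumes "M \<in> carrier_mat 2 2"
  obtains a b c d where "M = mat2 a b c d"
proof -
  have "M = mat2 (M $$ (0, 0)) (M $$ (0, 1)) (M $$ (1, 0)) (M $$ (1, 1))"
    using assms by (intro eq_matI) (auto simp: less_2_nat)
  then show thesis by (rule that)
qed

lemma mat2_add [simp]:
  "mat2 a b c d + mat2 a' b' c' d' = mat2 (a + a') (b + b') (c + c') (d + d')"
  by (intro eq_matI) (auto simp: less_2_nat)

lemma atLeast0LessThan_2: "{0..<2::nat} = {0, 1}"
  by auto

lemma mat2_mult [simp]:
  fixes a :: "'a :: semiring_0"
  shows "mat2 a b c d * mat2 a' b' c' d' =
    mat2 (a * a' + b * c') (a * b' + b * d') (c * a' + d * c') (c * b' + d * d')"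
  by (intro eq_matI) (auto simp: less_2_nat scalar_prod_def atLeast0LessThan_2)

lemma one_mat_2: "1\<^sub>m 2 = mat2 1 0 0 1"
  by (intro eq_matI) (auto simp: less_2_nat)

section \<open>Powers of square matrices\<close>

lemma pow_mat_add:
  fixes A :: "'a :: semiring_1 mat"
  assumes A: "A \<in> carrier_mat n n"
  shows "A ^\<^sub>m (k + l) = A ^\<^sub>m k * A ^\<^sub>m l"
proof -
  interpret semiring "ring_mat TYPE('a) n ()" by (rule semiring_mat)
  show ?thesis
    using nat_pow_mult[of A k l] A
    by (simp add: pow_mat_ring_pow[OF A, where b = "()"] ring_mat_simps)
qed

lemma pow_mat_mult:
  fixes A :: "'a :: semiring_1 mat"
  assumes A: "A \<in> carrier_mat n n"
  shows "(A ^\<^sub>m k) ^\<^sub>m l = A ^\<^sub>m (k * l)"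
proof -
  interpret semiring "ring_mat TYPE('a) n ()" by (rule semiring_mat)
  show ?thesis
    using nat_pow_pow[of A k l] A
    unfolding pow_mat_ring_pow[OF pow_carrier_mat[OF A], where b = "()"]
    by (simp add: pow_mat_ring_pow[OF A, where b = "()"] ring_mat_simps)
qed

lemma pow_mat_idempotent:
  assumes "A \<in> carrier_mat n n" "A * A = A" "k > 0"
  shows "A ^\<^sub>m k = A"
  using assms(3)
proof (induction k)
  case (Suc k)
  then show ?case using assms by (cases "k = 0") auto
qed simp

lemma one_mat_pow: "1\<^sub>m n ^\<^sub>m k = 1\<^sub>m n"
  by (induction k) simp_all

lemma pow_mat_numeral: "A ^\<^sub>m numeral n = A ^\<^sub>m pred_numeral n * A"
  by (simp add: numeral_eq_Suc)

text \<open>Invertible matrices over \<open>bit\<close> have order 1, 2 or 3, so their sixth power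
  is 1. Singular ones satisfy \<open>A^2 = tr(A) A\<close>, so they are idempotent or have square 0.
  The proof checks all 16 matrices.\<close>

lemma pow_mat2_bit_8:
  fixes A :: "bit mat"
  assumes "A \<in> carrier_mat 2 2"
  shows "A ^\<^sub>m 8 = A ^\<^sub>m 2"
proof -
  obtain a b c d where A: "A = mat2 a b c d"
    using assms by (rule carrier_mat_2_cases)
  show ?thesis unfolding A
    by (cases a; cases b; cases c; cases d) (simp_all add: pow_mat_numeral one_mat_2)
qed

text \<open>The bound on \<open>k\<close> is due to nonzero nilpotent matrices: their seventh power
  is 0, not the first power.\<close>

lemma pow_mat2_bit_periodic:
  fixes A :: "bit mat"
  assumes A: "A \<in> carrier_mat 2 2" and "k \<ge> 2"
  shows "A ^\<^sub>m (k + 6 * q) = A ^\<^sub>m k"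
proof (induction q)
  case (Suc q)
  obtain m where m: "k + 6 * q = 2 + m"
    using \<open>k \<ge> 2\<close> by (metis le_add1 le_Suc_ex le_trans)
  have "A ^\<^sub>m (k + 6 * Suc q) = A ^\<^sub>m (8 + m)"
    using m by (intro arg_cong[where f = "pow_mat A"]) simp
  also have "\<dots> = A ^\<^sub>m (2 + m)"
    using pow_mat2_bit_8[OF A] by (simp only: pow_mat_add[OF A])
  finally show ?case using Suc m by simp
qed simp

section \<open>Elements of order 3 and sums of idempotents\<close>

text \<open>The identity together with these two matrices is the multiplicative group of a copy of
  the field with four elements.\<close>

definition F4_gens :: "bit mat set" where
  "F4_gens = {mat2 1 1 1 0, mat2 0 1 1 1}"

lemma F4_gens_iff:
  fixes M :: "bit mat"
  assumes "M \<in> carrier_mat 2 2"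
  shows "M \<in> F4_gens \<longleftrightarrow> M ^\<^sub>m 3 = 1\<^sub>m 2 \<and> M \<noteq> 1\<^sub>m 2"
proof -
  obtain a b c d where M: "M = mat2 a b c d"
    using assms by (rule carrier_mat_2_cases)
  show ?thesis unfolding M
    by (cases a; cases b; cases c; cases d)
      (simp_all add: pow_mat_numeral one_mat_2 F4_gens_def)
qed

text \<open>Members of \<open>F4_gens\<close> have trace 1 and are invertible. If
  \<open>A + B\<close> has trace 1, one idempotent has rank 1 and the other is 0 or 1, so the sum is
  again an idempotent of rank 1, hence singular. The proof itself is a case check.\<close>

lemma sum_idempotents_not_F4_gens:
  fixes A B :: "bit mat"
  assumes "A \<in> carrier_mat 2 2" "B \<in> carrier_mat 2 2" "A * A = A" "B * B = B"
  shows "A + B \<notin> F4_gens"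
proof -
  obtain a b c d where A: "A = mat2 a b c d"
    using assms(1) by (rule carrier_mat_2_cases)
  obtain p q r s where B: "B = mat2 p q r s"
    using assms(2) by (rule carrier_mat_2_cases)
  show ?thesis using assms(3,4) unfolding A B F4_gens_def
    \<comment> \<open>The first \<open>simp\<close> discards every \<open>A\<close> that is not
      idempotent before \<open>B\<close> is split.\<close>
    by (cases a; cases b; cases c; cases d; simp; cases p; cases q; cases r; cases s; simp)
qed

lemma not_F4_gens_sum_idempotents:
  fixes M :: "bit mat"
  assumes "M \<in> carrier_mat 2 2" "M \<notin> F4_gens"
  obtains A B where "A \<in> carrier_mat 2 2" "B \<in> carrier_mat 2 2"
    "A * A = A" "B * B = B" "M = A + B"
proof -
  obtain a b c d where M: "M = mat2 a b c d"
    using assms(1) by (rule carrier_mat_2_cases)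
  show thesis
  proof (cases "a = d")
    case True
    \<comment> \<open>A triangular matrix with diagonal entries 0 and 1 is idempotent.\<close>
    show thesis
    proof (rule that[of "mat2 a b 0 (a + 1)" "mat2 0 0 c 1"])
      show "M = mat2 a b 0 (a + 1) + mat2 0 0 c 1"
        using True by (cases a) (simp_all add: M)
    qed (cases a; simp)+
  next
    case False
    \<comment> \<open>The trace is 1, and so \<open>M\<close> is idempotent unless its determinant is 1.\<close>
    show thesis
    proof (rule that[of M "mat2 0 0 0 0"])
      show "M * M = M"
        using False assms(2) unfolding M F4_gens_def
        by (cases a; cases b; cases c; cases d) simp_all
    qed (simp_all add: M)
  qed
qed

section \<open>Elements of order 3 as sums of powers, and their order in the group\<close>

lemma F4_gens_carrier: "M \<in> F4_gens \<Longrightarrow> M \<in> carrier_mat 2 2"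
  by (auto simp: F4_gens_def)

lemma F4_gens_sum_of_powers:
  assumes M: "M \<in> F4_gens" and "\<not> 6 dvd k"
  obtains A B :: "bit mat" where "A \<in> carrier_mat 2 2" "B \<in> carrier_mat 2 2"
    "M = A ^\<^sub>m k + B ^\<^sub>m k"
proof (cases "3 dvd k")
  case False
  \<comment> \<open>An inverse of \<open>k\<close> modulo 3, so that \<open>M ^\<^sub>m l\<close> is
    a \<open>k\<close>-th root of \<open>M\<close>.\<close>
  define l where "l = (if k mod 3 = 1 then 1 else 2 :: nat)"
  have "l * k mod 3 = 1"
  proof (cases "k mod 3 = 1")
    case False
    then have "k mod 3 = 2"
      using \<open>\<not> 3 dvd k\<close> by presburger
    then show ?thesis using False by (simp add: l_def mod_mult_right_eq[symmetric, of 2 k])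
  qed (simp add: l_def)
  then obtain q where q: "l * k = 3 * q + 1"
    by (metis mult_div_mod_eq)
  have c: "M \<in> carrier_mat 2 2" and M3: "M ^\<^sub>m 3 = 1\<^sub>m 2"
    using M F4_gens_carrier F4_gens_iff by blast+
  have "(M ^\<^sub>m l) ^\<^sub>m k = (M ^\<^sub>m 3) ^\<^sub>m q * M"
    using c by (simp add: pow_mat_mult[OF c] q)
  also have "\<dots> = M"
    using c by (simp add: M3 one_mat_pow)
  finally have 1: "(M ^\<^sub>m l) ^\<^sub>m k = M" .
  \<comment> \<open>The other summand is 0; for \<open>k = 0\<close> its power would be the
    identity.\<close>
  have "k > 0" using assms(2) by (cases k) auto
  then have "0\<^sub>m 2 2 ^\<^sub>m k = (0\<^sub>m 2 2 :: bit mat)"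
    by (intro pow_mat_idempotent[of _ 2]) auto
  then have "M = (M ^\<^sub>m l) ^\<^sub>m k + 0\<^sub>m 2 2 ^\<^sub>m k"
    using 1 c by simp
  then show thesis using c by (intro that) auto
next
  case True
  then have "k mod 2 = 1" using assms(2) by presburger
  then obtain q where q: "k = 2 * q + 1"
    by (metis mult_div_mod_eq)
  let ?S = "mat2 0 1 1 0 :: bit mat"
  have "?S ^\<^sub>m 2 = 1\<^sub>m 2"
    by (simp add: pow_mat_numeral one_mat_2)
  then have S: "?S ^\<^sub>m k = ?S"
    unfolding q pow_mat_add[OF mat2_carrier] pow_mat_mult[OF mat2_carrier, symmetric]
    by (simp add: one_mat_pow)
  have I: "E ^\<^sub>m k = E" if "E \<in> carrier_mat 2 2" "E * E = E" for E :: "bit mat"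
    using that q by (intro pow_mat_idempotent) auto
  from M consider "M = mat2 1 0 0 0 + ?S" | "M = mat2 0 0 0 1 + ?S"
    by (auto simp: F4_gens_def)
  then show thesis
  proof cases
    case 1
    then have "M = mat2 1 0 0 0 ^\<^sub>m k + ?S ^\<^sub>m k" by (simp add: S I)
    then show thesis by (rule that[OF mat2_carrier mat2_carrier])
  next
    case 2
    then have "M = mat2 0 0 0 1 ^\<^sub>m k + ?S ^\<^sub>m k" by (simp add: S I)
    then show thesis by (rule that[OF mat2_carrier mat2_carrier])
  qed
qed

text \<open>For a unit, \<open>M^3 = 1\<close> says that the order divides the prime 3, and
  \<open>M \<noteq> 1\<close> rules out order 1.\<close>

lemma F4_gens_eq_order_3: "F4_gens = {M \<in> carrier GL2_F2. group.ord GL2_F2 M = 3}"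
proof -
  let ?R = "ring_mat TYPE(bit) 2 ()"
  interpret R: semiring ?R by (rule semiring_mat)
  interpret G: group GL2_F2 by (rule R.units_group)
  have "M \<in> F4_gens \<longleftrightarrow> M \<in> Units ?R \<and> G.ord M = 3" for M
  proof (cases "M \<in> Units ?R")
    case True
    then have c: "M \<in> carrier_mat 2 2"
      using R.Units_closed by (simp add: ring_mat_simps)
    have u: "M \<in> carrier GL2_F2" using True by (simp add: units_of_carrier)
    have "M ^\<^sub>m 3 = 1\<^sub>m 2 \<longleftrightarrow> G.ord M dvd 3"
      using G.pow_eq_id[OF u, of 3] R.units_of_pow[OF True, of 3]
      by (simp add: pow_mat_ring_pow[OF c, where b = "()"] units_of_one ring_mat_simps)
    moreover have "M = 1\<^sub>m 2 \<longleftrightarrow> G.ord M = 1"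
      using G.ord_eq_1[OF u] by (simp add: units_of_one ring_mat_simps)
    moreover have "n dvd 3 \<longleftrightarrow> n = 1 \<or> n = 3" for n :: nat
    proof
      assume "n dvd 3"
      moreover from this have "n \<le> 3" by (rule dvd_imp_le) simp
      then have "n = 0 \<or> n = 1 \<or> n = 2 \<or> n = 3" by linarith
      ultimately show "n = 1 \<or> n = 3" by auto
    qed auto
    ultimately show ?thesis
      using True F4_gens_iff[OF c] by auto
  next
    case False
    \<comment> \<open>From \<open>M^3 = 1\<close>, the square of \<open>M\<close> is a two-sided
      inverse.\<close>
    have "M \<in> Units ?R" if M: "M \<in> F4_gens"
    proof -
      have c: "M \<in> carrier_mat 2 2" and M3: "M ^\<^sub>m 3 = 1\<^sub>m 2"
        using M F4_gens_carrier F4_gens_iff by blast+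
      have "M ^\<^sub>m 1 = M"
        using c by simp
      moreover have "M ^\<^sub>m (2 + 1) = 1\<^sub>m 2" "M ^\<^sub>m (1 + 2) = 1\<^sub>m 2"
        using M3 by (simp_all add: numeral_eq_Suc)
      ultimately have "M ^\<^sub>m 2 * M = 1\<^sub>m 2" "M * M ^\<^sub>m 2 = 1\<^sub>m 2"
        by (simp_all only: pow_mat_add[OF c])
      then show ?thesis
        using c pow_carrier_mat[OF c, of 2]
        by (auto simp: Units_def ring_mat_simps)
    qed
    with False show ?thesis by blast
  qed
  then show ?thesis by (auto simp: units_of_carrier)
qed

theorem theorem6p1:
  fixes k :: nat and P E :: "bit mat set"
  assumes "k \<ge> 2"
    and "P = {A ^\<^sub>m k + B ^\<^sub>m k | A B. A \<in> carrier_mat 2 2 \<and> B \<in> carrier_mat 2 2}"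
    and "E = {mat_of_rows_list 2 [[1, 1], [1, 0]], mat_of_rows_list 2 [[0, 1], [1, 1]]}"
  shows "(\<not> [k = 0] (mod 6) \<longrightarrow> P = carrier_mat 2 2) \<and>
         ([k = 0] (mod 6) \<longrightarrow> P = carrier_mat 2 2 - E) \<and>
         E = {M \<in> carrier GL2_F2. group.ord GL2_F2 M = 3}"
proof -
  have E: "E = F4_gens"
    by (simp add: assms(3) F4_gens_def mat2_def)
  have P_sub: "P \<subseteq> carrier_mat 2 2"
    unfolding assms(2) by auto
  have sub_P: "carrier_mat 2 2 - F4_gens \<subseteq> P"
  proof
    fix M assume "M \<in> carrier_mat 2 2 - F4_gens"
    then obtain A B where AB: "A \<in> carrier_mat 2 2" "B \<in> carrier_mat 2 2"
        "A * A = A" "B * B = B" "M = A + B"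
      by (auto elim: not_F4_gens_sum_idempotents)
    then have "M = A ^\<^sub>m k + B ^\<^sub>m k"
      using assms(1) by (simp add: pow_mat_idempotent)
    with AB show "M \<in> P" unfolding assms(2) by blast
  qed
  have "P = carrier_mat 2 2" if "\<not> 6 dvd k"
  proof -
    have "F4_gens \<subseteq> P"
    proof
      fix M assume "M \<in> F4_gens"
      then show "M \<in> P"
        using that by (rule F4_gens_sum_of_powers) (unfold assms(2), blast)
    qed
    with P_sub sub_P show ?thesis by blast
  qed
  moreover have "P = carrier_mat 2 2 - F4_gens" if "6 dvd k"
  proof -
    have idem: "A ^\<^sub>m k * A ^\<^sub>m k = A ^\<^sub>m k" if "A \<in> carrier_mat 2 2" for A :: "bit mat"
    proof -
      \<comment> \<open>Here \<open>k + k = k + 6 * q\<close>, so periodicity reduces the exponent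
        of the product to \<open>k\<close>.\<close>
      obtain q where "k = 6 * q" using \<open>6 dvd k\<close> by (rule dvdE)
      then show ?thesis
        using pow_mat2_bit_periodic[OF that assms(1), of q] pow_mat_add[OF that, of k k] by simp
    qed
    have "M \<notin> F4_gens" if M: "M \<in> P" for M
    proof -
      obtain A B where "A \<in> carrier_mat 2 2" "B \<in> carrier_mat 2 2" "M = A ^\<^sub>m k + B ^\<^sub>m k"
        using M unfolding assms(2) by blast
      then show ?thesis
        by (simp add: idem sum_idempotents_not_F4_gens)
    qed
    with P_sub sub_P show ?thesis by blast
  qed
  ultimately show ?thesis
    using F4_gens_eq_order_3 by (simp add: E cong_0_iff)
qed

end
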